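(* Let $(X,d)$ be a compact metric space, let $R_1,\dots,R_N$ be contractive iterated function systems on $X$, let $Z\in K^*(X)$ and $\theta\in\Omega=\{1,\dots,N\}^{\mathbb N}$, and let $\mathcal A(\theta)$ be the blend of the attractors $A_{R_i}$, $i=1,\dots,N$, by $\theta$. Let $\delta>0$. Then there exist $k\in\mathbb N$ and $\varepsilon>0$ such that, if $B=Y_1$ is the approximation of the blend of the attractors $A_{R_i}$, $i=1,\dots,N$, by $\theta$ with resolution $\varepsilon$ (computed from $Z$, the word $\theta_1,\dots,\theta_k$, and a finite discretization $(\hat X,r)$ of $X$ with resolution $\varepsilon$), then $d_H(\mathcal A(\theta),B)\le\delta$.
   Context: $K^*(X)$ is the set of non-empty compact subsets of $X$, with the Hausdorff--Pompeiu distance $d_H(A,B)=\max(d(A,B),d(B,A))$, where $d(A,B)=\sup_{a\in A}\inf_{b\in B}d(a,b)$. A contractive iterated function system (IFS) $R=(X,f_j,\,j=1,\dots,n)$ is a finite family of maps $f_j:X\to X$ together with numbers $\lambda_j\in[0,1)$ such that $\operatorname{Lip}(f_j)<\lambda_j$ for all $j$. Its Hutchinson--Barnsley operator is $F_R(B)=\bigcup_{j=1}^n f_j(B)$; it maps $K^*(X)$ to itself, and its attractor $A_R$ is the unique element of $K^*(X)$ with $F_R(A_R)=A_R$. Given contractive IFSs $R_i=(X,f^i_j,\,j=1,\dots,n_i)$, $i=1,\dots,N$, and $\theta=(\theta_1,\theta_2,\dots)\in\Omega:=\{1,\dots,N\}^{\mathbb N}$, the blend of the attractors $A_{R_i}$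 by $\theta$ is $$\mathcal A(\theta):=\lim_{k\to\infty}F_{R_{\theta_1}}(F_{R_{\theta_2}}(\cdots F_{R_{\theta_k}}(Z)))\in K^*(X),$$ the limit being in $d_H$; it exists and does not depend on $Z\in K^*(X)$. A set $\hat X\subset X$ is an $\varepsilon$-net if for every $x\in X$ there is $y\in\hat X$ with $d(x,y)\le\varepsilon$; $\varepsilon$ is called the resolution. A map $r:X\to\hat X$ is an $\varepsilon$-projection if $r|_{\hat X}=\mathrm{id}$ and $d(x,r(x))\le\varepsilon$ for all $x\in X$. The pair $(\hat X,r)$ is a finite discretization of $X$ (with resolution $\varepsilon$) if $\hat X$ is a finite $\varepsilon$-net and $r:X\to\hat X$ is an $\varepsilon$-projection. For $B\subset X$, $\widehat B:=r(B)\subset\hat X$. Given $Z\in K^*(X)$, $\theta\in\Omega$, $k\ge1$ and a finite discretization $(\hat X,r)$ with resolution $\varepsilon$, define $$Y_{k+1}=\widehat Z,\qquad Y_j=\widehat{F_{R_{\theta_j}}(\widehat{Y_{j+1}})},\quad 1\le j\le k .$$ The set $B:=Y_1$ is called the approximation of the blend of the attractors $A_{R_i}$, $i=1,\dots,N$, by $\theta$ with resolution $\varepsilon$. *)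

theory Defs
  imports "HOL-Analysis.Analysis"
begin

text \<open>
  The ambient space \<open>X\<close> is a type of class \<^class>\<open>metric_space\<close>; its compactness is assumed
  where it is needed, as \<open>compact UNIV\<close>.
\<close>

definition Kstar :: "'a::metric_space set set"
  where "Kstar = {K. compact K \<and> K \<noteq> {}}"

text \<open>
  The directed distance is only meaningful for non-empty bounded sets: otherwise
  \<^const>\<open>infdist\<close> (which is \<open>0\<close> for the empty set) or the real supremum is a dummy value.
\<close>

definition dir_dist :: "'a::metric_space set \<Rightarrow> 'a set \<Rightarrow> real"
  where "dir_dist A B = (SUP a\<in>A. infdist a B)"

definition hausdorff_dist :: "'a::metric_space set \<Rightarrow> 'a set \<Rightarrow> real"
  where "hausdorff_dist A B = max (dir_dist A B) (dir_dist B A)"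

text \<open>
  The least Lipschitz constant, taken in \<open>[0, \<infinity>]\<close> so that it is \<open>\<infinity>\<close> for a map that is not
  Lipschitz. The pairs with \<open>x = y\<close> contribute \<open>0 / 0 = 0\<close>.
\<close>

definition Lip :: "('a::metric_space \<Rightarrow> 'a) \<Rightarrow> ennreal"
  where "Lip f = (SUP (x, y)\<in>UNIV. ennreal (dist (f x) (f y) / dist x y))"

text \<open>An IFS is the list of the pairs \<open>(f\<^sub>j, \<lambda>\<^sub>j)\<close>, \<open>j = 1, \<dots>, n\<close>, with \<open>n \<ge> 1\<close>.\<close>

type_synonym 'a ifs = "(('a \<Rightarrow> 'a) \<times> real) list"

definition contractive_ifs :: "'a::metric_space ifs \<Rightarrow> bool"
  where "contractive_ifs R \<longleftrightarrow>
    R \<noteq> [] \<and> (\<forall>(f, l)\<in>set R. 0 \<le> l \<and> l < 1 \<and> Lip f < ennreal l)"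

definition hutchinson :: "'a ifs \<Rightarrow> 'a set \<Rightarrow> 'a set"
  where "hutchinson R B = (\<Union>(f, l)\<in>set R. f ` B)"

text \<open>
  Families of IFSs and words are functions on \<^typ>\<open>nat\<close> indexed from \<open>1\<close>; values at \<open>0\<close>
  (and, for families, beyond \<open>N\<close>) are irrelevant.
\<close>

definition words :: "nat \<Rightarrow> (nat \<Rightarrow> nat) set"
  where "words N = {1..} \<rightarrow> {1..N}"

definition blend_iterate :: "(nat \<Rightarrow> 'a ifs) \<Rightarrow> (nat \<Rightarrow> nat) \<Rightarrow> nat \<Rightarrow> 'a set \<Rightarrow> 'a set"
  where "blend_iterate R \<theta> k Z = foldr (\<lambda>j. hutchinson (R (\<theta> j))) [1..<Suc k] Z"

definition blend :: "(nat \<Rightarrow> 'a::metric_space ifs) \<Rightarrow> (nat \<Rightarrow> nat) \<Rightarrow> 'a set"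
  where "blend R \<theta> = (THE A. A \<in> Kstar \<and>
    (\<forall>Z\<in>Kstar. (\<lambda>k. hausdorff_dist (blend_iterate R \<theta> k Z) A) \<longlonglongrightarrow> 0))"

definition eps_net :: "real \<Rightarrow> 'a::metric_space set \<Rightarrow> bool"
  where "eps_net \<epsilon> Xh \<longleftrightarrow> (\<forall>x. \<exists>y\<in>Xh. dist x y \<le> \<epsilon>)"

definition eps_projection :: "real \<Rightarrow> 'a::metric_space set \<Rightarrow> ('a \<Rightarrow> 'a) \<Rightarrow> bool"
  where "eps_projection \<epsilon> Xh r \<longleftrightarrow>
    range r \<subseteq> Xh \<and> (\<forall>x\<in>Xh. r x = x) \<and> (\<forall>x. dist x (r x) \<le> \<epsilon>)"

definition finite_discretization :: "real \<Rightarrow> 'a::metric_space set \<Rightarrow> ('a \<Rightarrow> 'a) \<Rightarrow> bool"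
  where "finite_discretization \<epsilon> Xh r \<longleftrightarrow> finite Xh \<and> eps_net \<epsilon> Xh \<and> eps_projection \<epsilon> Xh r"

text \<open>
  The sets \<open>Y\<^sub>j\<close> of the discretized backward iteration, \<open>1 \<le> j \<le> k + 1\<close>, starting with
  \<open>Y\<^bsub>k+1\<^esub>\<close>; the discretization of a set is its image under the projection \<open>r\<close>.
\<close>

function blend_approx_step ::
  "(nat \<Rightarrow> 'a ifs) \<Rightarrow> (nat \<Rightarrow> nat) \<Rightarrow> ('a \<Rightarrow> 'a) \<Rightarrow> 'a set \<Rightarrow> nat \<Rightarrow> nat \<Rightarrow> 'a set"
  where
    "k < j \<Longrightarrow> blend_approx_step R \<theta> r Z k j = r ` Z"
  | "j \<le> k \<Longrightarrow> blend_approx_step R \<theta> r Z k j =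
      r ` hutchinson (R (\<theta> j)) (r ` blend_approx_step R \<theta> r Z k (Suc j))"
  by (atomize_elim, auto)
termination
  by (relation "Wellfounded.measure (\<lambda>(R, \<theta>, r, Z, k, j). Suc k - j)") auto

definition blend_approx ::
  "(nat \<Rightarrow> 'a ifs) \<Rightarrow> (nat \<Rightarrow> nat) \<Rightarrow> ('a \<Rightarrow> 'a) \<Rightarrow> 'a set \<Rightarrow> nat \<Rightarrow> 'a set"
  where "blend_approx R \<theta> r Z k = blend_approx_step R \<theta> r Z k 1"

end

theory Submission
  imports Defs
begin

text \<open>
  Two independent errors separate the blend from its approximation.

  Truncation: all maps of \<open>R\<^sub>1, \<dots>, R\<^sub>N\<close> share one Lipschitz constant \<open>L < 1\<close>, so the \<open>k\<close>-th
  iterates of any two non-empty sets are within \<open>L ^ k\<close> times the diameter of \<open>X\<close>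
  (\<open>hclose_foldr_hutchinson\<close>). Since \<open>X\<close> is compact it can itself be used as starting set: its
  iterates decrease, and their intersection is the limit of all iterations
  (\<open>eventually_hclose_core\<close>). Hausdorff limits of compact sets are unique, so this intersection is
  the blend (\<open>blend_eq_core\<close>). Fix \<open>k\<close> for which the iterate of \<open>Z\<close> is within
  \<open>\<delta> / 2\<close> of the blend.

  Discretization: each step moves points by at most \<open>2 * \<epsilon>\<close> and the maps do not expand
  distances, so errors only add up, to at most \<open>(2 * k + 1) * \<epsilon>\<close>
  (\<open>hclose_blend_approx\<close>). Once \<open>k\<close> is fixed, \<open>\<epsilon>\<close> can be chosen to make this at most \<open>\<delta> / 2\<close>.

  Both estimates are made with the relation \<open>hclose\<close>, which makes sense for arbitrary sets and
  composes well. On non-empty sets it corresponds to an upper bound on the Hausdorff distance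
  (\<open>hausdorff_dist_le\<close>, \<open>hclose_if_hausdorff_dist_less\<close>).
\<close>

section \<open>Closeness of sets\<close>

definition near :: "real \<Rightarrow> 'a::metric_space set \<Rightarrow> 'a set \<Rightarrow> bool"
  where "near e A B \<longleftrightarrow> (\<forall>a\<in>A. \<exists>b\<in>B. dist a b \<le> e)"

definition hclose :: "real \<Rightarrow> 'a::metric_space set \<Rightarrow> 'a set \<Rightarrow> bool"
  where "hclose e A B \<longleftrightarrow> near e A B \<and> near e B A"

lemma near_trans: "near d A B \<Longrightarrow> near e B C \<Longrightarrow> near (d + e) A C"
  unfolding near_def by (meson add_mono dist_triangle order_trans)

lemma hclose_sym: "hclose e A B \<Longrightarrow> hclose e B A"
  by (simp add: hclose_def)

lemma hclose_trans: "hclose d A B \<Longrightarrow> hclose e B C \<Longrightarrow> hclose (d + e) A C"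
  unfolding hclose_def by (metis near_trans add.commute)

lemma hclose_mono: "hclose d A B \<Longrightarrow> d \<le> e \<Longrightarrow> hclose e A B"
  unfolding hclose_def near_def by (meson order_trans)

lemma hclose_image:
  assumes "\<And>x. dist x (r x) \<le> e"
  shows "hclose e (r ` A) A"
  using assms unfolding hclose_def near_def by (auto simp: dist_commute)

lemma hclose_if_dist_le:
  fixes A B :: "'a::metric_space set"
  assumes "\<And>x y :: 'a. dist x y \<le> D" "A \<noteq> {}" "B \<noteq> {}"
  shows "hclose D A B"
  using assms unfolding hclose_def near_def by blast

lemma dir_dist_le:
  assumes "A \<noteq> {}" "near e A B"
  shows "dir_dist A B \<le> e"
  unfolding dir_dist_def
proof (rule cSUP_least)
  show "infdist a B \<le> e" if "a \<in> A" for a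
    using assms(2) that unfolding near_def by (meson infdist_le2)
qed fact

lemma hausdorff_dist_le:
  assumes "A \<noteq> {}" "B \<noteq> {}" "hclose e A B"
  shows "hausdorff_dist A B \<le> e"
  using assms by (simp add: hausdorff_dist_def hclose_def dir_dist_le)

text \<open>
  Boundedness of the space makes the real supremum in \<^const>\<open>dir_dist\<close> a genuine one.
\<close>

lemma infdist_le_dir_dist:
  fixes A B :: "'a::metric_space set"
  assumes bdd: "bounded (UNIV :: 'a set)" and ne: "B \<noteq> {}" and a: "a \<in> A"
  shows "infdist a B \<le> dir_dist A B"
proof -
  obtain D where D: "\<And>x y :: 'a. dist x y \<le> D"
    using bdd unfolding bounded_two_points by auto
  have "bdd_above ((\<lambda>a. infdist a B) ` A)"
  proof (rule bdd_aboveI2)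
    show "infdist x B \<le> D" for x
      using ne D by (meson ex_in_conv infdist_le2)
  qed
  then show ?thesis
    unfolding dir_dist_def by (rule cSUP_upper[OF a])
qed

lemma hausdorff_dist_nonneg:
  fixes A B :: "'a::metric_space set"
  assumes "bounded (UNIV :: 'a set)" "A \<noteq> {}" "B \<noteq> {}"
  shows "0 \<le> hausdorff_dist A B"
proof -
  obtain a where "a \<in> A"
    using assms(2) by blast
  then have "0 \<le> dir_dist A B"
    using infdist_le_dir_dist[OF assms(1,3)] infdist_nonneg order_trans by blast
  then show ?thesis
    by (simp add: hausdorff_dist_def le_max_iff_disj)
qed

text \<open>
  The hypothesis is strict because an infimum of distances need not be attained.
\<close>

lemma near_if_dir_dist_less:
  fixes A B :: "'a::metric_space set"
  assumes bdd: "bounded (UNIV :: 'a set)" and ne: "B \<noteq> {}" and less: "dir_dist A B < e"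
  shows "near e A B"
  unfolding near_def
proof
  fix a assume "a \<in> A"
  then have "infdist a B < e"
    using infdist_le_dir_dist[OF bdd ne] less by fastforce
  then show "\<exists>b\<in>B. dist a b \<le> e"
    using ne by (auto simp: infdist_notempty cINF_less_iff intro: less_imp_le)
qed

lemma hclose_if_hausdorff_dist_less:
  fixes A B :: "'a::metric_space set"
  assumes "bounded (UNIV :: 'a set)" "A \<noteq> {}" "B \<noteq> {}" "hausdorff_dist A B < e"
  shows "hclose e A B"
  using assms by (simp add: hausdorff_dist_def hclose_def near_if_dir_dist_less)

lemma subset_if_near:
  assumes "closed B" "\<And>e. e > 0 \<Longrightarrow> near e A B"
  shows "A \<subseteq> B"
proof
  fix a assume a: "a \<in> A"
  have "\<exists>b\<in>B. dist b a < e" if "e > 0" for e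
  proof -
    have "near (e / 2) A B"
      using assms(2) that by simp
    then obtain b where "b \<in> B" "dist a b \<le> e / 2"
      using a unfolding near_def by blast
    then show ?thesis
      using that by (intro bexI[of _ b]) (auto simp: dist_commute)
  qed
  then show "a \<in> B"
    using closed_approachable[OF assms(1)] by blast
qed

lemma nested_closed_nonempty:
  fixes F :: "nat \<Rightarrow> 'a::topological_space set"
  assumes "compact (UNIV :: 'a set)" "\<And>n. closed (F n)" "\<And>n. F n \<noteq> {}" "decseq F"
  shows "(\<Inter>n. F n) \<noteq> {}"
  using compact_space_imp_nest[of euclidean F] assms by (simp add: compact_space_def)

section \<open>The Hutchinson--Barnsley operator\<close>

lemma lipschitz_on_if_Lip_less:
  assumes "Lip f < ennreal l" "0 \<le> l"
  shows "l-lipschitz_on UNIV f"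
proof (rule lipschitz_onI)
  fix x y
  have "ennreal (dist (f x) (f y) / dist x y) \<le> Lip f"
    unfolding Lip_def by (rule SUP_upper2[of "(x, y)"]) auto
  then have "ennreal (dist (f x) (f y) / dist x y) \<le> ennreal l"
    using assms(1) by simp
  then have "dist (f x) (f y) / dist x y \<le> l"
    using assms(2) by simp
  then show "dist (f x) (f y) \<le> l * dist x y"
    by (cases "x = y") (auto simp: divide_simps)
qed fact

text \<open>Finitely many systems with finitely many maps each: the largest \<open>\<lambda>\<^sub>j\<close> is below \<open>1\<close>.\<close>

lemma common_contraction_factor:
  assumes "finite I" "\<And>i. i \<in> I \<Longrightarrow> contractive_ifs (R i)"
  obtains L where "0 \<le> L" "L < 1" "\<And>i p. i \<in> I \<Longrightarrow> p \<in> set (R i) \<Longrightarrow> L-lipschitz_on UNIV (fst p)"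
proof -
  define M where "M = insert 0 (snd ` (\<Union>i\<in>I. set (R i)))"
  have fin: "finite M" "M \<noteq> {}"
    using assms(1) by (auto simp: M_def)
  have "0 \<le> Max M"
    using fin by (simp add: M_def)
  moreover have "Max M < 1"
    using assms(2) fin by (force simp: M_def contractive_ifs_def)
  moreover have "(Max M)-lipschitz_on UNIV (fst p)" if "i \<in> I" "p \<in> set (R i)" for i p
  proof -
    have "0 \<le> snd p" "Lip (fst p) < ennreal (snd p)"
      using assms(2)[OF that(1)] that(2) by (auto simp: contractive_ifs_def case_prod_beta)
    then have "(snd p)-lipschitz_on UNIV (fst p)"
      by (rule lipschitz_on_if_Lip_less[rotated])
    moreover have "snd p \<le> Max M"
      using fin that by (intro Max_ge) (auto simp: M_def)
    ultimately show ?thesis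
      by (rule lipschitz_on_le)
  qed
  ultimately show thesis
    by (rule that)
qed

lemma hutchinson_mono: "A \<subseteq> B \<Longrightarrow> hutchinson R A \<subseteq> hutchinson R B"
  unfolding hutchinson_def by auto

lemma hutchinson_nonempty: "R \<noteq> [] \<Longrightarrow> A \<noteq> {} \<Longrightarrow> hutchinson R A \<noteq> {}"
  unfolding hutchinson_def by (cases R) auto

lemma compact_hutchinson:
  assumes "\<And>p. p \<in> set R \<Longrightarrow> L-lipschitz_on UNIV (fst p)" "compact A"
  shows "compact (hutchinson R A)"
  unfolding hutchinson_def
proof (rule compact_UN)
  show "compact (case p of (f, l) \<Rightarrow> f ` A)" if "p \<in> set R" for p
    using assms(1)[OF that] assms(2)
    by (auto simp: case_prod_beta intro!: compact_continuous_image
        elim!: continuous_on_subset[OF lipschitz_on_continuous_on])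
qed simp

lemma near_hutchinson:
  assumes "\<And>p. p \<in> set R \<Longrightarrow> L-lipschitz_on UNIV (fst p)" "0 \<le> L" "near e A B"
  shows "near (L * e) (hutchinson R A) (hutchinson R B)"
  unfolding near_def
proof
  fix u assume "u \<in> hutchinson R A"
  then obtain p a where p: "p \<in> set R" "a \<in> A" "u = fst p a"
    by (auto simp: hutchinson_def)
  then obtain b where b: "b \<in> B" "dist a b \<le> e"
    using assms(3) unfolding near_def by blast
  have "dist u (fst p b) \<le> L * dist a b"
    using lipschitz_onD[OF assms(1)[OF p(1)]] p(3) by simp
  also have "\<dots> \<le> L * e"
    using b(2) assms(2) by (rule mult_left_mono)
  finally have "dist u (fst p b) \<le> L * e" .
  moreover have "fst p b \<in> hutchinson R B"
    using p(1) b(1) by (auto simp: hutchinson_def case_prod_beta)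
  ultimately show "\<exists>v\<in>hutchinson R B. dist u v \<le> L * e"
    by blast
qed

lemma hclose_hutchinson:
  assumes "\<And>p. p \<in> set R \<Longrightarrow> L-lipschitz_on UNIV (fst p)" "0 \<le> L" "hclose e A B"
  shows "hclose (L * e) (hutchinson R A) (hutchinson R B)"
  using assms by (simp add: hclose_def near_hutchinson)

lemma hclose_foldr_hutchinson:
  assumes "\<And>j p. j \<in> set js \<Longrightarrow> p \<in> set (R j) \<Longrightarrow> L-lipschitz_on UNIV (fst p)"
    and "0 \<le> L" "hclose e A B"
  shows "hclose (L ^ length js * e) (foldr (\<lambda>j. hutchinson (R j)) js A)
    (foldr (\<lambda>j. hutchinson (R j)) js B)"
  using assms(1)
proof (induction js)
  case Nil
  then show ?case
    using assms(3) by simp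
next
  case (Cons j js)
  have "hclose (L * (L ^ length js * e))
      (hutchinson (R j) (foldr (\<lambda>j. hutchinson (R j)) js A))
      (hutchinson (R j) (foldr (\<lambda>j. hutchinson (R j)) js B))"
    using Cons assms(2) by (intro hclose_hutchinson) auto
  then show ?case
    by (simp add: mult.assoc)
qed

section \<open>The blend as a nested intersection\<close>

text \<open>
  Once \<open>\<theta>\<close> is chosen, only the systems \<open>R (\<theta> j)\<close> along the word matter, and they share the
  contraction factor \<open>L\<close>.
\<close>

locale lipschitz_word =
  fixes R :: "nat \<Rightarrow> 'a::metric_space ifs" and \<theta> :: "nat \<Rightarrow> nat" and L :: real
  assumes compact_space: "compact (UNIV :: 'a set)"
    and factor: "0 \<le> L" "L < 1"
    and lipschitz: "\<And>j p. 1 \<le> j \<Longrightarrow> p \<in> set (R (\<theta> j)) \<Longrightarrow> L-lipschitz_on UNIV (fst p)"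
    and nonempty_ifs: "\<And>j. 1 \<le> j \<Longrightarrow> R (\<theta> j) \<noteq> []"
begin

abbreviation iter :: "nat \<Rightarrow> 'a set \<Rightarrow> 'a set"
  where "iter \<equiv> blend_iterate R \<theta>"

definition core :: "'a set"
  where "core = (\<Inter>k. iter k UNIV)"

lemma iter_0: "iter 0 A = A"
  by (simp add: blend_iterate_def)

lemma iter_Suc: "iter (Suc k) A = iter k (hutchinson (R (\<theta> (Suc k))) A)"
  by (simp add: blend_iterate_def)

lemma iter_mono: "A \<subseteq> B \<Longrightarrow> iter k A \<subseteq> iter k B"
  by (induction k arbitrary: A B) (simp_all add: iter_0 iter_Suc hutchinson_mono)

lemma iter_nonempty: "A \<noteq> {} \<Longrightarrow> iter k A \<noteq> {}"
  by (induction k arbitrary: A) (simp_all add: iter_0 iter_Suc hutchinson_nonempty nonempty_ifs)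

lemma compact_iter: "compact A \<Longrightarrow> compact (iter k A)"
proof (induction k arbitrary: A)
  case (Suc k)
  have "compact (hutchinson (R (\<theta> (Suc k))) A)"
    using lipschitz[of "Suc k"] Suc.prems by (intro compact_hutchinson) auto
  then show ?case
    unfolding iter_Suc by (rule Suc.IH)
qed (simp add: iter_0)

lemma hclose_iter:
  assumes "hclose e A B"
  shows "hclose (L ^ k * e) (iter k A) (iter k B)"
proof -
  have "L-lipschitz_on UNIV (fst p)" if "j \<in> set [1..<Suc k]" "p \<in> set (R (\<theta> j))" for j p
    using lipschitz[of j p] that by (simp del: upt_Suc)
  from hclose_foldr_hutchinson[of "[1..<Suc k]" "\<lambda>j. R (\<theta> j)", OF this factor(1) assms]
  show ?thesis
    by (simp add: blend_iterate_def del: upt_Suc)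
qed

lemma decseq_iter_UNIV: "decseq (\<lambda>k. iter k UNIV)"
  by (intro decseq_SucI) (simp add: iter_Suc iter_mono)

lemma core_subset: "core \<subseteq> iter k UNIV"
  unfolding core_def by blast

lemma core_in_Kstar: "core \<in> Kstar"
proof -
  have closed: "closed (iter k UNIV)" for k
    by (intro compact_imp_closed compact_iter compact_space)
  have "core \<noteq> {}"
    unfolding core_def
    by (intro nested_closed_nonempty compact_space closed iter_nonempty decseq_iter_UNIV) simp
  moreover have "compact core"
    using closed compact_Int_closed[OF compact_space, of core] by (auto simp: core_def)
  ultimately show ?thesis
    by (simp add: Kstar_def)
qed

text \<open>
  If no iterate were contained in an open neighbourhood of the intersection, the complements of
  the neighbourhood in the iterates would be nested non-empty compact sets with empty intersection.
\<close>

lemma eventually_iter_UNIV_subset: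
  assumes "open U" "core \<subseteq> U"
  shows "\<forall>\<^sub>F k in sequentially. iter k UNIV \<subseteq> U"
proof -
  have "\<exists>m. iter m UNIV \<subseteq> U"
  proof (rule ccontr)
    assume "\<nexists>m. iter m UNIV \<subseteq> U"
    then have "(\<Inter>k. iter k UNIV - U) \<noteq> {}"
      using assms(1) decseq_iter_UNIV
      by (intro nested_closed_nonempty closed_Diff compact_imp_closed compact_iter compact_space)
        (fastforce simp: decseq_def)+
    then show False
      using assms(2) unfolding core_def by blast
  qed
  then show ?thesis
    using decseq_iter_UNIV unfolding decseq_def eventually_sequentially by (meson subset_trans)
qed

lemma eventually_hclose_core_UNIV:
  assumes "e > 0"
  shows "\<forall>\<^sub>F k in sequentially. hclose e (iter k UNIV) core"
proof -
  have "\<forall>\<^sub>F k in sequentially. iter k UNIV \<subseteq> (\<Union>a\<in>core. ball a e)"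
    using assms by (intro eventually_iter_UNIV_subset) auto
  then show ?thesis
  proof eventually_elim
    case (elim k)
    have "near e (iter k UNIV) core"
      using elim unfolding near_def by (force simp: dist_commute)
    moreover have "near e core (iter k UNIV)"
      using core_subset assms unfolding near_def by (metis dist_self less_imp_le subsetD)
    ultimately show ?case
      by (simp add: hclose_def)
  qed
qed

text \<open>
  The iterates of \<open>A\<close> are compared with those of the whole space: both sides start within the
  diameter of the space, and \<open>k\<close> contractions shrink this distance to \<open>0\<close>.
\<close>

lemma eventually_hclose_core:
  assumes "e > 0" "A \<noteq> {}"
  shows "\<forall>\<^sub>F k in sequentially. hclose e (iter k A) core"
proof -
  obtain D where D: "\<And>x y :: 'a. dist x y \<le> D"
    using compact_imp_bounded[OF compact_space] unfolding bounded_two_points by auto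
  have "(\<lambda>k. L ^ k * D) \<longlonglongrightarrow> 0 * D"
    using factor by (intro tendsto_mult LIMSEQ_power_zero tendsto_const) auto
  then have "\<forall>\<^sub>F k in sequentially. L ^ k * D < e / 2"
    using assms(1) by (intro order_tendstoD(2)) auto
  moreover have "\<forall>\<^sub>F k in sequentially. hclose (e / 2) (iter k UNIV) core"
    using assms(1) by (intro eventually_hclose_core_UNIV) simp
  ultimately show ?thesis
  proof eventually_elim
    case (elim k)
    have "hclose D A UNIV"
      using D assms(2) by (intro hclose_if_dist_le) auto
    then have "hclose (e / 2) (iter k A) (iter k UNIV)"
      using elim(1) by (intro hclose_mono[OF hclose_iter]) auto
    then show ?case
      using hclose_trans[OF _ elim(2)] by fastforce
  qed
qed

lemma iter_tendsto_core:
  assumes "A \<in> Kstar"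
  shows "(\<lambda>k. hausdorff_dist (iter k A) core) \<longlonglongrightarrow> 0"
proof (rule tendstoI)
  fix e :: real assume e: "e > 0"
  have ne: "A \<noteq> {}" "core \<noteq> {}"
    using assms core_in_Kstar by (auto simp: Kstar_def)
  have "\<forall>\<^sub>F k in sequentially. hclose (e / 2) (iter k A) core"
    using e ne by (intro eventually_hclose_core) auto
  then show "\<forall>\<^sub>F k in sequentially. dist (hausdorff_dist (iter k A) core) 0 < e"
  proof eventually_elim
    case (elim k)
    have "hausdorff_dist (iter k A) core \<le> e / 2"
      using elim ne iter_nonempty by (intro hausdorff_dist_le) auto
    moreover have "0 \<le> hausdorff_dist (iter k A) core"
      using ne iter_nonempty compact_imp_bounded[OF compact_space]
      by (intro hausdorff_dist_nonneg) auto
    ultimately show ?case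
      using e by simp
  qed
qed

text \<open>
  Two limits of one sequence of sets are arbitrarily close to each other, and closed sets with this
  property coincide.
\<close>

lemma limit_unique:
  assumes "B \<in> Kstar" "(\<lambda>k. hausdorff_dist (iter k UNIV) B) \<longlonglongrightarrow> 0"
  shows "B = core"
proof -
  have ne: "B \<noteq> {}" "core \<noteq> {}" and closed: "closed B" "closed core"
    using assms(1) core_in_Kstar by (auto simp: Kstar_def compact_imp_closed)
  have "hclose e B core" if "e > 0" for e
  proof -
    have "\<forall>\<^sub>F k in sequentially. hausdorff_dist (iter k UNIV) B < e / 2"
      using that by (intro order_tendstoD(2)[OF assms(2)]) simp
    moreover have "\<forall>\<^sub>F k in sequentially. hclose (e / 2) (iter k UNIV) core"
      using that by (intro eventually_hclose_core_UNIV) simp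
    ultimately have "\<forall>\<^sub>F k in sequentially. hclose e B core"
    proof eventually_elim
      case (elim k)
      have "hclose (e / 2) (iter k UNIV) B"
        using elim(1) ne iter_nonempty compact_imp_bounded[OF compact_space]
        by (intro hclose_if_hausdorff_dist_less) auto
      from hclose_trans[OF hclose_sym[OF this] elim(2)] show ?case
        by simp
    qed
    then show ?thesis
      by simp
  qed
  then show ?thesis
    using closed by (intro equalityI subset_if_near) (auto simp: hclose_def)
qed

lemma blend_eq_core: "blend R \<theta> = core"
  unfolding blend_def
proof (rule the_equality)
  show "core \<in> Kstar \<and> (\<forall>Z\<in>Kstar. (\<lambda>k. hausdorff_dist (iter k Z) core) \<longlonglongrightarrow> 0)"
    using core_in_Kstar iter_tendsto_core by blast
  have "(UNIV :: 'a set) \<in> Kstar"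
    using compact_space by (simp add: Kstar_def)
  then show "B = core"
    if "B \<in> Kstar \<and> (\<forall>Z\<in>Kstar. (\<lambda>k. hausdorff_dist (iter k Z) B) \<longlonglongrightarrow> 0)" for B
    using that by (intro limit_unique) auto
qed

section \<open>The discretization error\<close>

text \<open>
  In each step the projection is applied twice, before and after the operator, which costs
  \<open>2 * \<epsilon>\<close>, while the error inherited from the previous step does not grow because \<open>L < 1\<close>;
  the initial projection of \<open>Z\<close> costs one more \<open>\<epsilon>\<close>.
\<close>

lemma hclose_blend_approx_step:
  assumes "\<And>x. dist x (r x) \<le> \<epsilon>" "1 \<le> j" "j \<le> Suc k"
  shows "hclose ((2 * real (Suc k - j) + 1) * \<epsilon>) (blend_approx_step R \<theta> r Z k j)
    (foldr (\<lambda>j. hutchinson (R (\<theta> j))) [j..<Suc k] Z)"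
  using assms(3,2)
proof (induction j rule: inc_induct)
  case base
  then show ?case
    using hclose_image[OF assms(1)] by simp
next
  case (step j)
  define Y W e where "Y = blend_approx_step R \<theta> r Z k (Suc j)"
    and "W = foldr (\<lambda>j. hutchinson (R (\<theta> j))) [Suc j..<Suc k] Z"
    and "e = (2 * real (Suc k - Suc j) + 1) * \<epsilon>"
  have \<epsilon>: "0 \<le> \<epsilon>"
    using assms(1) zero_le_dist order_trans by blast
  have "hclose (\<epsilon> + e) (r ` Y) W"
    using step by (intro hclose_trans[OF hclose_image[OF assms(1)]]) (simp add: Y_def W_def e_def)
  then have "hclose (L * (\<epsilon> + e)) (hutchinson (R (\<theta> j)) (r ` Y)) (hutchinson (R (\<theta> j)) W)"
    using lipschitz step.prems factor(1) by (intro hclose_hutchinson) auto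
  then have "hclose (\<epsilon> + e) (hutchinson (R (\<theta> j)) (r ` Y)) (hutchinson (R (\<theta> j)) W)"
    by (rule hclose_mono) (use \<epsilon> factor in \<open>auto simp: e_def intro!: mult_left_le_one_le\<close>)
  from hclose_trans[OF hclose_image[OF assms(1)] this]
  have "hclose (\<epsilon> + (\<epsilon> + e)) (blend_approx_step R \<theta> r Z k j) (hutchinson (R (\<theta> j)) W)"
    using step.hyps by (simp add: Y_def)
  moreover have "\<epsilon> + (\<epsilon> + e) = (2 * real (Suc k - j) + 1) * \<epsilon>"
    using step.hyps by (simp add: e_def Suc_diff_le algebra_simps of_nat_diff)
  moreover have "[j..<Suc k] = j # [Suc j..<Suc k]"
    using step.hyps by (simp add: upt_conv_Cons)
  ultimately show ?case
    by (simp add: W_def)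
qed

lemma hclose_blend_approx:
  assumes "\<And>x. dist x (r x) \<le> \<epsilon>"
  shows "hclose ((2 * real k + 1) * \<epsilon>) (blend_approx R \<theta> r Z k) (iter k Z)"
  using hclose_blend_approx_step[OF assms, of 1 k Z]
  by (simp add: blend_approx_def blend_iterate_def del: upt_Suc)

end

section \<open>Approximating the blend\<close>

theorem corollary4p5:
  fixes R :: "nat \<Rightarrow> 'a::metric_space ifs" and N :: nat
    and Z :: "'a set" and \<theta> :: "nat \<Rightarrow> nat" and \<delta> :: real
  assumes "compact (UNIV :: 'a set)"
    and "\<And>i. i \<in> {1..N} \<Longrightarrow> contractive_ifs (R i)"
    and "Z \<in> Kstar"
    and "\<theta> \<in> words N"
    and "\<delta> > 0"
  shows "\<exists>k\<ge>1. \<exists>\<epsilon>>0. \<forall>Xh r. finite_discretization \<epsilon> Xh r \<longrightarrow>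
    hausdorff_dist (blend R \<theta>) (blend_approx R \<theta> r Z k) \<le> \<delta>"
proof -
  obtain L where L: "0 \<le> L" "L < 1"
    "\<And>i p. i \<in> {1..N} \<Longrightarrow> p \<in> set (R i) \<Longrightarrow> L-lipschitz_on UNIV (fst p)"
    using common_contraction_factor[of "{1..N}" R] assms(2) by blast
  have \<theta>: "\<theta> j \<in> {1..N}" if "1 \<le> j" for j
    using assms(4) that unfolding words_def by blast
  interpret lipschitz_word R \<theta> L
  proof
    show "R (\<theta> j) \<noteq> []" if "1 \<le> j" for j
      using assms(2)[OF \<theta>[OF that]] by (simp add: contractive_ifs_def)
  qed (use assms(1) L \<theta> in auto)
  have ne: "Z \<noteq> {}" "core \<noteq> {}"
    using assms(3) core_in_Kstar by (auto simp: Kstar_def)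
  have "\<forall>\<^sub>F k in sequentially. 1 \<le> k \<and> hclose (\<delta> / 2) (iter k Z) core"
    using assms(5) ne by (intro eventually_conj eventually_ge_at_top eventually_hclose_core) auto
  then obtain k where k: "1 \<le> k" "hclose (\<delta> / 2) (iter k Z) core"
    using eventually_happens'[OF sequentially_bot] by blast
  define \<epsilon> where "\<epsilon> = \<delta> / 2 / (2 * real k + 1)"
  have \<epsilon>: "\<epsilon> > 0" "(2 * real k + 1) * \<epsilon> = \<delta> / 2"
    using assms(5) by (simp_all add: \<epsilon>_def field_simps add_pos_nonneg)
  have "hausdorff_dist (blend R \<theta>) (blend_approx R \<theta> r Z k) \<le> \<delta>"
    if "finite_discretization \<epsilon> Xh r" for Xh r
  proof -
    have "dist x (r x) \<le> \<epsilon>" for x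
      using that by (simp add: finite_discretization_def eps_projection_def)
    then have "hclose (\<delta> / 2) (blend_approx R \<theta> r Z k) (iter k Z)"
      using hclose_blend_approx[of r \<epsilon> k Z] unfolding \<epsilon>(2) by blast
    from hclose_trans[OF this k(2)] have close: "hclose \<delta> core (blend_approx R \<theta> r Z k)"
      by (simp add: hclose_sym)
    moreover have "blend_approx R \<theta> r Z k \<noteq> {}"
      using close ne(2) unfolding hclose_def near_def by blast
    ultimately show ?thesis
      unfolding blend_eq_core using ne(2) by (intro hausdorff_dist_le)
  qed
  then show ?thesis
    using k(1) \<epsilon>(1) by blast
qed

end
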